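(* Let $d_A,d_B\ge1$ be integers and define the $(d_Ad_B)^2\times(d_Ad_B)^2$ matrix $$K_B=\sum_{i,j=1}^{d_B}\left(I_{d_A}\otimes J_{d_B}^{ji}\right)\otimes\left(I_{d_A}\otimes J_{d_B}^{ij}\right).$$ Then for every complex $d_Ad_B\times d_Ad_B$ matrix $\rho$, $$\mathrm{vec}\,\rho^{T_B}=K_B\,\mathrm{vec}\,\rho .$$
   Context: $\otimes$ is the Kronecker product, $I_m$ is the $m\times m$ identity matrix, and $J_m^{ij}$ is the $m\times m$ single-entry matrix with $(J_m^{ij})_{kl}=\delta_{ik}\delta_{jl}$. $\mathrm{vec}\,X$ is the column vector obtained by stacking the columns of $X$. The partial transpose $X\mapsto X^{T_B}$ is the complex-linear map on $d_Ad_B\times d_Ad_B$ matrices determined by $(Y\otimes Z)^{T_B}=Y\otimes Z^T$ for $Y$ of size $d_A\times d_A$ and $Z$ of size $d_B\times d_B$. *)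

theory Defs
  imports "Jordan_Normal_Form.Matrix"
begin

(* All matrix and vector indices are 0-based. *)

definition kronecker :: "'a :: times mat \<Rightarrow> 'a mat \<Rightarrow> 'a mat" (infixl "\<otimes>\<^sub>K" 72) where
  "A \<otimes>\<^sub>K B = mat (dim_row A * dim_row B) (dim_col A * dim_col B)
     (\<lambda>(i, j). A $$ (i div dim_row B, j div dim_col B) * B $$ (i mod dim_row B, j mod dim_col B))"

definition single_entry :: "nat \<Rightarrow> nat \<Rightarrow> nat \<Rightarrow> 'a :: {zero, one} mat" where
  "single_entry m i j = mat m m (\<lambda>(k, l). if i = k \<and> j = l then 1 else 0)"

definition vectorize :: "'a mat \<Rightarrow> 'a vec" where
  "vectorize X = vec_of_list (concat (map list_of_vec (cols X)))"

definition is_partial_transpose_B ::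
  "nat \<Rightarrow> nat \<Rightarrow> (complex mat \<Rightarrow> complex mat) \<Rightarrow> bool" where
  "is_partial_transpose_B dA dB T \<longleftrightarrow>
     (let M = carrier_mat (dA * dB) (dA * dB) in
      T \<in> M \<rightarrow>\<^sub>E M \<and>
      (\<forall>X \<in> M. \<forall>Y \<in> M. T (X + Y) = T X + T Y) \<and>
      (\<forall>c. \<forall>X \<in> M. T (c \<cdot>\<^sub>m X) = c \<cdot>\<^sub>m T X) \<and>
      (\<forall>Y \<in> carrier_mat dA dA. \<forall>Z \<in> carrier_mat dB dB. T (Y \<otimes>\<^sub>K Z) = Y \<otimes>\<^sub>K Z\<^sup>T))"

(* Existence and uniqueness of the map described here: lemma ex1_partial_transpose_B below. *)
definition partial_transpose_B :: "nat \<Rightarrow> nat \<Rightarrow> complex mat \<Rightarrow> complex mat" where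
  "partial_transpose_B dA dB = (THE T. is_partial_transpose_B dA dB T)"

definition K_B :: "nat \<Rightarrow> nat \<Rightarrow> complex mat" where
  "K_B dA dB =
     finsum (module_mat TYPE(complex) ((dA * dB)\<^sup>2) ((dA * dB)\<^sup>2))
       (\<lambda>(i, j). (1\<^sub>m dA \<otimes>\<^sub>K single_entry dB j i) \<otimes>\<^sub>K (1\<^sub>m dA \<otimes>\<^sub>K single_entry dB i j))
       ({..<dB} \<times> {..<dB})"

lemma kronecker_dim [simp]:
  "dim_row (A \<otimes>\<^sub>K B) = dim_row A * dim_row B"
  "dim_col (A \<otimes>\<^sub>K B) = dim_col A * dim_col B"
  by (simp_all add: kronecker_def)

lemma kronecker_carrier [simp, intro]:
  "A \<in> carrier_mat r c \<Longrightarrow> B \<in> carrier_mat r' c' \<Longrightarrow> A \<otimes>\<^sub>K B \<in> carrier_mat (r * r') (c * c')"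
  by (intro carrier_matI) (simp_all only: kronecker_dim carrier_matD)

lemma single_entry_carrier [simp, intro]: "single_entry m i j \<in> carrier_mat m m"
  by (simp add: single_entry_def)

lemma length_concat_const:
  "\<forall>xs \<in> set xss. length xs = r \<Longrightarrow> length (concat xss) = r * length xss"
  by (induction xss) simp_all

lemma nth_concat_const:
  "\<forall>xs \<in> set xss. length xs = r \<Longrightarrow> k < r * length xss \<Longrightarrow>
     concat xss ! k = xss ! (k div r) ! (k mod r)"
proof (induction xss arbitrary: k)
  case Nil
  then show ?case by simp
next
  case (Cons xs xss)
  have len: "length xs = r" using Cons.prems by simp
  show ?case
  proof (cases "k < r")
    case True
    then show ?thesis by (simp add: len nth_append)
  next
    case False
    have r: "r > 0" using Cons.prems(2) by (cases r) auto
    have "concat xss ! (k - r) = xss ! ((k - r) div r) ! ((k - r) mod r)"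
      using Cons.prems False by (intro Cons.IH) auto
    moreover have "k div r = Suc ((k - r) div r)" "k mod r = (k - r) mod r"
      using False r by (simp_all add: le_div_geq le_mod_geq)
    ultimately show ?thesis using False by (simp add: len nth_append)
  qed
qed

lemma dim_vectorize [simp]: "dim_vec (vectorize X) = dim_row X * dim_col X"
  unfolding vectorize_def dim_vec_of_list
  by (subst length_concat_const[where r = "dim_row X"]) (auto simp: cols_def)

lemma index_vectorize:
  assumes "k < dim_row X * dim_col X"
  shows "vectorize X $ k = X $$ (k mod dim_row X, k div dim_row X)"
proof -
  have r: "dim_row X > 0" using assms by (cases "dim_row X") auto
  have d: "k div dim_row X < dim_col X"
    using assms by (simp add: less_mult_imp_div_less mult.commute)
  have m: "k mod dim_row X < dim_row X" using r by simp
  have "vectorize X $ k = concat (map list_of_vec (cols X)) ! k"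
    by (simp add: vectorize_def vec_of_list_index)
  also have "\<dots> = map list_of_vec (cols X) ! (k div dim_row X) ! (k mod dim_row X)"
    using assms by (intro nth_concat_const) (auto simp: cols_def)
  also have "\<dots> = X $$ (k mod dim_row X, k div dim_row X)"
    using d m by (simp add: list_of_vec_index)
  finally show ?thesis .
qed

lemma index_kronecker:
  assumes "A \<in> carrier_mat r c" "B \<in> carrier_mat r' c'" "i < r * r'" "j < c * c'"
  shows "(A \<otimes>\<^sub>K B) $$ (i, j) = A $$ (i div r', j div c') * B $$ (i mod r', j mod c')"
  using assms by (auto simp: kronecker_def)

lemma block_index_less:
  fixes a b d m :: nat
  assumes "a < m" "b < d"
  shows "a * d + b < m * d"
proof -
  have "a * d + b < Suc a * d" using assms by simp
  also have "\<dots> \<le> m * d" using assms by (intro mult_le_mono1) simp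
  finally show ?thesis .
qed

definition ptB_fun :: "nat \<Rightarrow> nat \<Rightarrow> complex mat \<Rightarrow> complex mat" where
  "ptB_fun dA dB = restrict
     (\<lambda>X. mat (dA * dB) (dA * dB)
        (\<lambda>(p, q). X $$ (p div dB * dB + q mod dB, q div dB * dB + p mod dB)))
     (carrier_mat (dA * dB) (dA * dB))"

lemma is_partial_transpose_B_ptB_fun: "is_partial_transpose_B dA dB (ptB_fun dA dB)"
proof -
  let ?n = "dA * dB"
  have lt: "p div dB * dB + q mod dB < ?n" if "p < ?n" "q < ?n" for p q
  proof -
    have "dB > 0" using that by (cases dB) auto
    then show ?thesis using that
      by (intro block_index_less) (auto simp: less_mult_imp_div_less)
  qed
  have "ptB_fun dA dB (Y \<otimes>\<^sub>K Z) = Y \<otimes>\<^sub>K Z\<^sup>T"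
    if Y: "Y \<in> carrier_mat dA dA" and Z: "Z \<in> carrier_mat dB dB" for Y Z
  proof (rule eq_matI)
    fix p q assume "p < dim_row (Y \<otimes>\<^sub>K Z\<^sup>T)" "q < dim_col (Y \<otimes>\<^sub>K Z\<^sup>T)"
    then have pq: "p < ?n" "q < ?n" using Y Z by auto
    then have B: "dB > 0" by (cases dB) auto
    have "ptB_fun dA dB (Y \<otimes>\<^sub>K Z) $$ (p, q)
        = (Y \<otimes>\<^sub>K Z) $$ (p div dB * dB + q mod dB, q div dB * dB + p mod dB)"
      using pq kronecker_carrier[OF Y Z] by (simp add: ptB_fun_def)
    also have "\<dots> = Y $$ (p div dB, q div dB) * Z $$ (q mod dB, p mod dB)"
      using B by (subst index_kronecker[OF Y Z lt[OF pq] lt[OF pq(2) pq(1)]]) simp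
    also have "\<dots> = (Y \<otimes>\<^sub>K Z\<^sup>T) $$ (p, q)"
      using pq B Z by (subst index_kronecker[of Y dA dA "Z\<^sup>T" dB dB]) (auto simp: Y)
    finally show "ptB_fun dA dB (Y \<otimes>\<^sub>K Z) $$ (p, q) = (Y \<otimes>\<^sub>K Z\<^sup>T) $$ (p, q)" .
  qed (use Y Z kronecker_carrier[OF Y Z] in \<open>auto simp: ptB_fun_def\<close>)
  moreover have "ptB_fun dA dB (X + Y) = ptB_fun dA dB X + ptB_fun dA dB Y"
    if "X \<in> carrier_mat ?n ?n" "Y \<in> carrier_mat ?n ?n" for X Y
    using that by (intro eq_matI) (auto simp: ptB_fun_def lt)
  moreover have "ptB_fun dA dB (c \<cdot>\<^sub>m X) = c \<cdot>\<^sub>m ptB_fun dA dB X"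
    if "X \<in> carrier_mat ?n ?n" for c X
    using that by (intro eq_matI) (auto simp: ptB_fun_def lt)
  moreover have "ptB_fun dA dB \<in> carrier_mat ?n ?n \<rightarrow>\<^sub>E carrier_mat ?n ?n"
    by (auto simp: ptB_fun_def)
  ultimately show ?thesis by (simp add: is_partial_transpose_B_def Let_def)
qed

lemma single_entry_kronecker:
  assumes "p < a * b" "q < a * b"
  shows "(single_entry (a * b) p q :: 'a :: semiring_1 mat)
    = single_entry a (p div b) (q div b) \<otimes>\<^sub>K single_entry b (p mod b) (q mod b)"
proof (rule eq_matI)
  fix k l
  assume "k < dim_row (single_entry a (p div b) (q div b) \<otimes>\<^sub>K single_entry b (p mod b) (q mod b) :: 'a mat)"
    "l < dim_col (single_entry a (p div b) (q div b) \<otimes>\<^sub>K single_entry b (p mod b) (q mod b) :: 'a mat)"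
  then have kl: "k < a * b" "l < a * b" by (auto simp: single_entry_def)
  have b: "b > 0" using kl by (cases b) auto
  have eq: "x = y \<longleftrightarrow> x div b = y div b \<and> x mod b = y mod b" for x y :: nat
    by (metis div_mult_mod_eq)
  show "(single_entry (a * b) p q :: 'a mat) $$ (k, l)
    = (single_entry a (p div b) (q div b) \<otimes>\<^sub>K single_entry b (p mod b) (q mod b)) $$ (k, l)"
    using kl b eq[of p k] eq[of q l]
    by (subst index_kronecker[OF single_entry_carrier single_entry_carrier])
       (auto simp: single_entry_def less_mult_imp_div_less)
qed (auto simp: single_entry_def)

lemma is_partial_transpose_B_unique:
  assumes "is_partial_transpose_B dA dB T" "is_partial_transpose_B dA dB T'"
  shows "T = T'"
proof -
  let ?n = "dA * dB"
  let ?M = "carrier_mat ?n ?n :: complex mat set"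
  have ext: "T \<in> ?M \<rightarrow>\<^sub>E ?M" "T' \<in> ?M \<rightarrow>\<^sub>E ?M"
    and add: "\<And>X Y. X \<in> ?M \<Longrightarrow> Y \<in> ?M \<Longrightarrow> T (X + Y) = T X + T Y"
      "\<And>X Y. X \<in> ?M \<Longrightarrow> Y \<in> ?M \<Longrightarrow> T' (X + Y) = T' X + T' Y"
    and scal: "\<And>c X. X \<in> ?M \<Longrightarrow> T (c \<cdot>\<^sub>m X) = c \<cdot>\<^sub>m T X"
      "\<And>c X. X \<in> ?M \<Longrightarrow> T' (c \<cdot>\<^sub>m X) = c \<cdot>\<^sub>m T' X"
    and kron: "\<And>Y Z. Y \<in> carrier_mat dA dA \<Longrightarrow> Z \<in> carrier_mat dB dB \<Longrightarrow> T (Y \<otimes>\<^sub>K Z) = Y \<otimes>\<^sub>K Z\<^sup>T"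
      "\<And>Y Z. Y \<in> carrier_mat dA dA \<Longrightarrow> Z \<in> carrier_mat dB dB \<Longrightarrow> T' (Y \<otimes>\<^sub>K Z) = Y \<otimes>\<^sub>K Z\<^sup>T"
    using assms unfolding is_partial_transpose_B_def Let_def by blast+
  have basis: "T (single_entry ?n p q) = T' (single_entry ?n p q)" if "p < ?n" "q < ?n" for p q
    using that by (simp add: single_entry_kronecker kron)
  have "T X = T' X" if X: "X \<in> ?M" for X
  proof -
    define P where "P S = mat ?n ?n (\<lambda>ij. if ij \<in> S then X $$ ij else 0)" for S
    have P: "P S \<in> ?M" for S by (simp add: P_def)
    have "T (P S) = T' (P S)" if "finite S" "S \<subseteq> {..<?n} \<times> {..<?n}" for S
      using that
    proof (induction S)
      case empty
      have "P {} = 0 \<cdot>\<^sub>m P {}" by (auto simp: P_def intro!: eq_matI)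
      then have "T (P {}) = 0 \<cdot>\<^sub>m T (P {})" "T' (P {}) = 0 \<cdot>\<^sub>m T' (P {})"
        using scal P by metis+
      moreover have "T (P {}) \<in> ?M" "T' (P {}) \<in> ?M" using ext P by blast+
      then have "0 \<cdot>\<^sub>m T (P {}) = 0 \<cdot>\<^sub>m T' (P {})" by (auto intro!: eq_matI)
      ultimately show ?case by simp
    next
      case (insert x S)
      obtain p q where x: "x = (p, q)" by force
      have pq: "p < ?n" "q < ?n" using insert.prems x by auto
      have s: "single_entry ?n p q \<in> ?M" "X $$ x \<cdot>\<^sub>m single_entry ?n p q \<in> ?M" by auto
      have "P (insert x S) = P S + X $$ x \<cdot>\<^sub>m single_entry ?n p q"
        using insert.hyps by (intro eq_matI) (auto simp: P_def x single_entry_def)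
      then show ?case
        using insert basis[OF pq] by (simp add: add[OF P s(2)] scal[OF s(1)])
    qed
    from this[of "{..<?n} \<times> {..<?n}"] have "T (P ({..<?n} \<times> {..<?n})) = T' (P ({..<?n} \<times> {..<?n}))"
      by simp
    moreover have "P ({..<?n} \<times> {..<?n}) = X" using X by (intro eq_matI) (auto simp: P_def)
    ultimately show ?thesis by simp
  qed
  then show ?thesis by (rule PiE_ext[OF ext])
qed

lemma ex1_partial_transpose_B: "\<exists>!T. is_partial_transpose_B dA dB T"
  using is_partial_transpose_B_ptB_fun is_partial_transpose_B_unique by blast

lemma partial_transpose_B_eq: "partial_transpose_B dA dB = ptB_fun dA dB"
  unfolding partial_transpose_B_def
  by (rule the_equality) (auto intro: is_partial_transpose_B_ptB_fun is_partial_transpose_B_unique)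

end

(* K_B is a permutation matrix. Write indices of (column-stacked) vec rho as q n + p with n = dA dB,
   p the row and q the column of rho. In row q n + p exactly one summand (i, j) of K_B is nonzero,
   namely i = p mod dB and j = q mod dB, and its only 1 sits in the column belonging to the entry
   obtained from (p, q) by swapping the residues mod dB, which is what the partial transpose does. *)
theory Submission
  imports Defs
begin

text \<open>Makes the general \<open>finsum\<close> rules available for the sum that defines
  \<open>K_B\<close>.\<close>

lemma abelian_monoid_mat: "abelian_monoid (module_mat TYPE('a :: semiring_1) m n)"
  by unfold_locales (auto simp: module_mat_def comm_add_mat)

text \<open>Zero and addition of \<open>module_mat\<close> act entrywise, so induction on
  \<open>I\<close> turns the algebraic \<open>finsum\<close> into an ordinary sum of
  numbers.\<close>

lemma index_finsum_mat:
  fixes f :: "'b \<Rightarrow> 'a :: semiring_1 mat"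
  assumes "finite I" "f \<in> I \<rightarrow> carrier_mat m n" "k < m" "l < n"
  shows "finsum (module_mat TYPE('a) m n) f I $$ (k, l) = (\<Sum>i\<in>I. f i $$ (k, l))"
proof -
  interpret abelian_monoid "module_mat TYPE('a) m n" by (rule abelian_monoid_mat)
  show ?thesis using assms(1,2)
  proof (induction I)
    case empty
    then show ?case using assms(3,4) by (simp add: module_mat_simps)
  next
    case (insert x I)
    then have f: "f x \<in> carrier_mat m n" "f \<in> I \<rightarrow> carrier_mat m n" by auto
    moreover from f have "finsum (module_mat TYPE('a) m n) f I \<in> carrier_mat m n"
      using finsum_closed[of f I] by (simp add: module_mat_simps)
    ultimately show ?case
      using insert assms(3,4) by (simp add: module_mat_simps)
  qed
qed

text \<open>The product is block diagonal: quotients by \<open>d\<close> number the blocks,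
  remainders give the position inside a block, and the entry is a product of two indicators.\<close>

lemma index_id_kronecker_single_entry:
  assumes "a < m * d" "b < m * d"
  shows "(1\<^sub>m m \<otimes>\<^sub>K single_entry d i j :: 'a :: semiring_1 mat) $$ (a, b)
    = (if a div d = b div d \<and> i = a mod d \<and> j = b mod d then 1 else 0)"
proof -
  have "d > 0" using assms by (cases d) auto
  then show ?thesis using assms
    by (subst index_kronecker[OF one_carrier_mat single_entry_carrier])
       (auto simp: single_entry_def less_mult_imp_div_less)
qed

lemma K_B_carrier: "K_B dA dB \<in> carrier_mat ((dA * dB)\<^sup>2) ((dA * dB)\<^sup>2)"
proof -
  interpret abelian_monoid "module_mat TYPE(complex) ((dA * dB)\<^sup>2) ((dA * dB)\<^sup>2)"
    by (rule abelian_monoid_mat)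
  show ?thesis unfolding K_B_def
    by (rule finsum_closed[unfolded module_mat_simps])
       (auto simp: power2_eq_square intro!: kronecker_carrier)
qed

lemma index_K_B:
  fixes dA dB k l :: nat
  defines "n \<equiv> dA * dB"
  defines "p \<equiv> k mod n" and "q \<equiv> k div n"
  assumes "k < n * n" "l < n * n"
  shows "K_B dA dB $$ (k, l)
    = (if l mod n = p div dB * dB + q mod dB \<and> l div n = q div dB * dB + p mod dB then 1 else 0)"
proof -
  have n: "n > 0" using assms(4) by (cases n) auto
  then have d: "dB > 0" by (cases dB) (auto simp: n_def)
  have lt: "p < n" "q < n" "l mod n < n" "l div n < n"
    using assms(4,5) n by (auto simp: p_def q_def less_mult_imp_div_less)
  \<comment> \<open>Uniqueness of quotient and remainder, with \<open>z mod dB\<close> below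
    \<open>dB\<close>; it splits the two equations of the claim into the four of
    \<open>?c\<close>.\<close>
  have eq: "x = y * dB + z mod dB \<longleftrightarrow> y = x div dB \<and> z mod dB = x mod dB" for x y z :: nat
    using d by auto
  let ?F = "\<lambda>(i, j). (1\<^sub>m dA \<otimes>\<^sub>K single_entry dB j i) \<otimes>\<^sub>K (1\<^sub>m dA \<otimes>\<^sub>K single_entry dB i j) :: complex mat"
  \<comment> \<open>Each of \<open>i\<close> and \<open>j\<close> is prescribed twice, once by the
    row \<open>k\<close> and once by the column \<open>l\<close>. \<open>?c\<close> says that these
    values agree and that the block numbers match.\<close>
  let ?c = "p div dB = l mod n div dB \<and> q div dB = l div n div dB
    \<and> p mod dB = l div n mod dB \<and> q mod dB = l mod n mod dB"
  have "K_B dA dB $$ (k, l) = (\<Sum>ij\<in>{..<dB} \<times> {..<dB}. ?F ij $$ (k, l))"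
    unfolding K_B_def
    using assms(4,5) by (intro index_finsum_mat) (auto simp: power2_eq_square n_def intro!: kronecker_carrier)
  \<comment> \<open>The row alone fixes the pair \<open>ij\<close>, and \<open>?c\<close> does not
    mention \<open>ij\<close>, so at most one summand survives.\<close>
  also have "\<dots> = (\<Sum>ij\<in>{..<dB} \<times> {..<dB}. if ij = (p mod dB, q mod dB) then if ?c then 1 else 0 else 0)"
  proof (rule sum.cong[OF refl])
    fix ij :: "nat \<times> nat"
    obtain i j where ij: "ij = (i, j)" by force
    have c: "(1\<^sub>m dA \<otimes>\<^sub>K single_entry dB i j :: complex mat) \<in> carrier_mat n n" for i j
      unfolding n_def by (intro kronecker_carrier) auto
    show "?F ij $$ (k, l) = (if ij = (p mod dB, q mod dB) then if ?c then 1 else 0 else 0)"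
      using lt unfolding ij prod.case index_kronecker[OF c c assms(4,5)]
      by (auto simp: p_def[symmetric] q_def[symmetric]
          index_id_kronecker_single_entry[of _ dA dB, folded n_def])
  qed
  also have "\<dots> = (if ?c then 1 else 0)"
    using d by (subst sum.delta) auto
  also have "?c \<longleftrightarrow> l mod n = p div dB * dB + q mod dB \<and> l div n = q div dB * dB + p mod dB"
    by (auto simp: eq)
  finally show ?thesis .
qed

theorem mainTheorem5:
  fixes dA dB :: nat and \<rho> :: "complex mat"
  assumes "dA \<ge> 1" and "dB \<ge> 1"
    and "\<rho> \<in> carrier_mat (dA * dB) (dA * dB)"
  shows "vectorize (partial_transpose_B dA dB \<rho>) = K_B dA dB *\<^sub>v vectorize \<rho>"
proof -
  define n where "n = dA * dB"
  have \<rho>: "\<rho> \<in> carrier_mat n n" using assms(3) by (simp add: n_def)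
  have n: "n > 0" using assms by (simp add: n_def)
  have K: "K_B dA dB \<in> carrier_mat (n * n) (n * n)"
    using K_B_carrier[of dA dB] by (simp add: n_def power2_eq_square)
  define R where "R = partial_transpose_B dA dB \<rho>"
  \<comment> \<open>The defining properties determine the partial transpose uniquely, so the
    explicit formula of \<open>ptB_fun\<close> may replace it.\<close>
  have R: "R = mat n n (\<lambda>(p, q). \<rho> $$ (p div dB * dB + q mod dB, q div dB * dB + p mod dB))"
    using \<rho> by (simp add: R_def partial_transpose_B_eq ptB_fun_def n_def)
  have "vectorize R = K_B dA dB *\<^sub>v vectorize \<rho>"
  proof (rule eq_vecI)
    fix k assume "k < dim_vec (K_B dA dB *\<^sub>v vectorize \<rho>)"
    then have k: "k < n * n" using K by simp
    define p q where "p = k mod n" and "q = k div n"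
    have pq: "p < n" "q < n" using k n by (auto simp: p_def q_def less_mult_imp_div_less)
    \<comment> \<open>\<open>(p', q')\<close> is the position in \<open>\<rho>\<close> of the entry
      that the partial transpose moves to \<open>(p, q)\<close>; its index in the stacked vector is
      \<open>q' * n + p'\<close>.\<close>
    define p' q' where "p' = p div dB * dB + q mod dB" and "q' = q div dB * dB + p mod dB"
    have pq': "p' < n" "q' < n"
      using pq assms(2) unfolding p'_def q'_def n_def
      by (auto intro!: block_index_less simp: less_mult_imp_div_less)
    have l': "q' * n + p' < n * n" using pq' by (intro block_index_less)
    have "(K_B dA dB *\<^sub>v vectorize \<rho>) $ k = (\<Sum>l<n * n. K_B dA dB $$ (k, l) * vectorize \<rho> $ l)"
      using k K \<rho> by (simp add: scalar_prod_def atLeast0LessThan)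
    also have "\<dots> = (\<Sum>l<n * n. if l = q' * n + p' then \<rho> $$ (p', q') else 0)"
    proof (rule sum.cong[OF refl])
      fix l assume "l \<in> {..<n * n}"
      then have l: "l < n * n" by simp
      \<comment> \<open>Since \<open>p'\<close> is below \<open>n\<close>, the two conditions of
        \<open>index_K_B\<close> single out one column \<open>l\<close>, which gives the sum its
        delta form.\<close>
      have "l = q' * n + p' \<longleftrightarrow> l mod n = p' \<and> l div n = q'"
        using pq' by (metis div_mult_mod_eq div_mult_self3 div_less mod_mult_self3 mod_less add_0_right n less_numeral_extra(3))
      then show "K_B dA dB $$ (k, l) * vectorize \<rho> $ l = (if l = q' * n + p' then \<rho> $$ (p', q') else 0)"
        using l k \<rho> index_K_B[of k dA dB l, folded n_def, folded p_def q_def, folded p'_def q'_def]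
        by (simp add: index_vectorize)
    qed
    also have "\<dots> = \<rho> $$ (p', q')" using l' by simp
    also have "\<dots> = vectorize R $ k"
      using k pq by (simp add: index_vectorize R p_def[symmetric] q_def[symmetric] p'_def q'_def)
    finally show "vectorize R $ k = (K_B dA dB *\<^sub>v vectorize \<rho>) $ k" by simp
  qed (use K in \<open>simp add: R\<close>)
  then show ?thesis by (simp add: R_def)
qed

end
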